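(* Let $z^{EQ}$ be a Wardrop equilibrium of a nonatomic mixed-autonomy congestion game with affine cost function $c(z)=Az+b$. Suppose $A=Q+P$, where $Q$ is a block diagonal matrix with $2\times2$ blocks having strictly positive entries on the block diagonal, and $P$ is positive definite. Let $k$ be the maximum degree of asymmetry for the cost function defined by $Q$. (a) If $z^{OPT}$ is a social optimum for this game and $k<4$, then $$C(z^{EQ})\le\left(\frac{4}{4-k}+\eta^2\right)C(z^{OPT}),$$ where $\eta^2=\lambda_{\max}\left(S^{-1/2}P^TS^{-1}PS^{-1/2}\right)$ and $S=(P+P^T)/2$. (b) If $w^{OPT}$ is a social optimum for the same game with $2+\frac{k}{4}$ times as many players of each type, then $C(z^{EQ})\le C(w^{OPT})$.
   Context: A nonatomic mixed-autonomy congestion game consists of a finite directed multigraph with $n\ge 1$ edges (roads), $m$ origin-destination pairs, and for each pair $j$ a mass $\alpha_j\ge 0$ of regular vehicles and a mass $\beta_j\ge 0$ of smart vehicles to be routed from its origin to its destination (each user is infinitesimal). A routing is a vector $z=(x_1,y_1,\dots,x_n,y_n)^T\in\mathbb{R}_{\ge0}^{2n}$, where $x_i,y_i$ are the masses of regular and smart vehicles on road $i$. $\mathcal{X}$ denotes the set of feasible routings: those induced by splitting each mass $\alpha_j$, and each mass $\beta_j$, among directed paths from origin to destination of pair $j$. The cost function is $c(z)=Az+b$ with $A\in\mathbb{R}_{\ge0}^{2n\times2n}$ and $b=(b_1,b_1,\dots,b_n,b_n)^T$, $b_i\ge0$; the components $2i-1$ and $2i$ of $c(z)$ are the delays on road $i$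 of regular and smart vehicles respectively. Social cost: $C(z)=\langle c(z),z\rangle$. A social optimum is a feasible routing attaining $\inf_{z\in\mathcal{X}}C(z)$. Maximum degree of asymmetry: the blocks of $Q$ are of the form $Q_i=\begin{bmatrix}k_ia_i&a_i\\k_ia_i&a_i\end{bmatrix}$ with $a_i>0$, $k_i>0$, $i=1,\dots,n$, and the maximum degree of asymmetry of the cost function $Qz+b$ is $k=\max_i\max(k_i,1/k_i)$. $P$ positive definite means $v^TPv>0$ for all nonzero $v\in\mathbb{R}^{2n}$; $P$ need not be symmetric. $\lambda_{\max}$ denotes the largest eigenvalue. A Wardrop equilibrium is a feasible routing in which, for each origin-destination pair and each vehicle type, all paths used by that type for that pair have equal delay for that type (sum of delays of the roads on the path), and no unused path for that pair has smaller delay for that type. "The same game with $p$ times as many players of each type" means the same network and cost function with all masses $\alpha_j,\beta_j$ replaced by $p\alpha_j,p\beta_j$. *)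

theory Defs
  imports "HOL-Analysis.Analysis" "Graph_Theory.Arc_Walk"
begin

datatype vehicle = Regular | Smart

lemma UNIV_vehicle: "UNIV = {Regular, Smart}"
  using vehicle.exhaust by auto

instance vehicle :: finite
  by standard (simp add: UNIV_vehicle)

text \<open>
  The roads are the elements of the finite type \<open>'e\<close> (so there is at least one), and
  \<open>\<real>\<^sup>2\<^sup>n\<close> is the space of vectors indexed by \<open>'e \<times> vehicle\<close>: the component \<open>(i, Regular)\<close> of a
  routing is \<open>x\<^sub>i\<close> and the component \<open>(i, Smart)\<close> is \<open>y\<^sub>i\<close>. The index \<open>j < pairs\<close> of an
  origin-destination pair ranges over an initial segment of the naturals, and \<open>mass j Regular\<close>,
  \<open>mass j Smart\<close> are \<open>\<alpha>\<^sub>j\<close>, \<open>\<beta>\<^sub>j\<close>.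
\<close>

type_synonym 'e flow = "real ^ ('e \<times> vehicle)"
type_synonym 'e matrix = "real ^ ('e \<times> vehicle) ^ ('e \<times> vehicle)"

record ('v, 'e) routing_game =
  network :: "('v, 'e) pre_digraph"
  pairs :: nat
  origin :: "nat \<Rightarrow> 'v"
  destination :: "nat \<Rightarrow> 'v"
  mass :: "nat \<Rightarrow> vehicle \<Rightarrow> real"
  cost_matrix :: "'e matrix"
  free_flow_delay :: "'e \<Rightarrow> real"

definition mixed_autonomy_game :: "('v, 'e::finite) routing_game \<Rightarrow> bool" where
  "mixed_autonomy_game \<Gamma> \<longleftrightarrow>
     fin_digraph (network \<Gamma>) \<and> arcs (network \<Gamma>) = UNIV \<and>
     (\<forall>j<pairs \<Gamma>. origin \<Gamma> j \<in> verts (network \<Gamma>) \<and> destination \<Gamma> j \<in> verts (network \<Gamma>)) \<and>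
     (\<forall>j<pairs \<Gamma>. \<forall>t. mass \<Gamma> j t \<ge> 0) \<and>
     (\<forall>r s. cost_matrix \<Gamma> $ r $ s \<ge> 0) \<and>
     (\<forall>i. free_flow_delay \<Gamma> i \<ge> 0)"

definition scale_players :: "real \<Rightarrow> ('v, 'e::finite) routing_game \<Rightarrow> ('v, 'e) routing_game" where
  "scale_players p \<Gamma> = \<Gamma>\<lparr>mass := (\<lambda>j t. p * mass \<Gamma> j t)\<rparr>"

definition cost :: "('v, 'e::finite) routing_game \<Rightarrow> 'e flow \<Rightarrow> 'e flow" where
  "cost \<Gamma> z = cost_matrix \<Gamma> *v z + (\<chi> r. free_flow_delay \<Gamma> (fst r))"

definition social_cost :: "('v, 'e::finite) routing_game \<Rightarrow> 'e flow \<Rightarrow> real" where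
  "social_cost \<Gamma> z = cost \<Gamma> z \<bullet> z"

text \<open>Paths do not repeat vertices; in particular there are finitely many of them.\<close>

definition od_paths :: "('v, 'e::finite) routing_game \<Rightarrow> nat \<Rightarrow> 'e list set" where
  "od_paths \<Gamma> j = {p. pre_digraph.apath (network \<Gamma>) (origin \<Gamma> j) p (destination \<Gamma> j)}"

definition feasible_path_flow ::
    "('v, 'e::finite) routing_game \<Rightarrow> (nat \<Rightarrow> vehicle \<Rightarrow> 'e list \<Rightarrow> real) \<Rightarrow> bool" where
  "feasible_path_flow \<Gamma> f \<longleftrightarrow>
     (\<forall>j<pairs \<Gamma>. \<forall>t. (\<forall>p\<in>od_paths \<Gamma> j. f j t p \<ge> 0) \<and> (\<Sum>p\<in>od_paths \<Gamma> j. f j t p) = mass \<Gamma> j t)"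

definition induced_routing ::
    "('v, 'e::finite) routing_game \<Rightarrow> (nat \<Rightarrow> vehicle \<Rightarrow> 'e list \<Rightarrow> real) \<Rightarrow> 'e flow" where
  "induced_routing \<Gamma> f =
     (\<chi> r. \<Sum>j<pairs \<Gamma>. \<Sum>p | p \<in> od_paths \<Gamma> j \<and> fst r \<in> set p. f j (snd r) p)"

definition feasible_routings :: "('v, 'e::finite) routing_game \<Rightarrow> 'e flow set" where
  "feasible_routings \<Gamma> = {induced_routing \<Gamma> f | f. feasible_path_flow \<Gamma> f}"

definition social_optimum :: "('v, 'e::finite) routing_game \<Rightarrow> 'e flow \<Rightarrow> bool" where
  "social_optimum \<Gamma> z \<longleftrightarrow>
     z \<in> feasible_routings \<Gamma> \<and> social_cost \<Gamma> z = (INF w\<in>feasible_routings \<Gamma>. social_cost \<Gamma> w)"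

definition path_delay ::
    "('v, 'e::finite) routing_game \<Rightarrow> 'e flow \<Rightarrow> vehicle \<Rightarrow> 'e list \<Rightarrow> real" where
  "path_delay \<Gamma> z t p = (\<Sum>i\<leftarrow>p. cost \<Gamma> z $ (i, t))"

text \<open>A path is used when it carries positive flow in a path decomposition of the routing.\<close>

definition wardrop_equilibrium :: "('v, 'e::finite) routing_game \<Rightarrow> 'e flow \<Rightarrow> bool" where
  "wardrop_equilibrium \<Gamma> z \<longleftrightarrow>
     (\<exists>f. feasible_path_flow \<Gamma> f \<and> z = induced_routing \<Gamma> f \<and>
       (\<forall>j<pairs \<Gamma>. \<forall>t. \<forall>p\<in>od_paths \<Gamma> j. \<forall>q\<in>od_paths \<Gamma> j. f j t p > 0 \<longrightarrow>
          (f j t q > 0 \<longrightarrow> path_delay \<Gamma> z t q = path_delay \<Gamma> z t p) \<and>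
          (f j t q = 0 \<longrightarrow> \<not> path_delay \<Gamma> z t q < path_delay \<Gamma> z t p)))"

text \<open>
  Block diagonal, with both rows of the \<open>i\<close>-th block equal to \<open>(\<kappa>\<^sub>i a\<^sub>i, a\<^sub>i)\<close>.
\<close>

definition block_matrix :: "('e::finite \<Rightarrow> real) \<Rightarrow> ('e \<Rightarrow> real) \<Rightarrow> 'e matrix" where
  "block_matrix \<kappa> a =
     (\<chi> r s. if fst r = fst s
             then (case snd s of Regular \<Rightarrow> \<kappa> (fst s) * a (fst s) | Smart \<Rightarrow> a (fst s))
             else 0)"

definition max_asymmetry :: "('e::finite \<Rightarrow> real) \<Rightarrow> real" where
  "max_asymmetry \<kappa> = Max (range (\<lambda>i. max (\<kappa> i) (1 / \<kappa> i)))"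

definition positive_definite :: "real ^ 'n ^ 'n \<Rightarrow> bool" where
  "positive_definite P \<longleftrightarrow> (\<forall>v. v \<noteq> 0 \<longrightarrow> v \<bullet> (P *v v) > 0)"

definition max_eigenvalue :: "real ^ 'n ^ 'n \<Rightarrow> real" where
  "max_eigenvalue M = (GREATEST \<mu>. \<exists>v. v \<noteq> 0 \<and> M *v v = \<mu> *\<^sub>R v)"

text \<open>
  Only meaningful for symmetric positive definite \<open>S\<close>, which has exactly one symmetric
  positive definite square root.
\<close>

definition matrix_sqrt :: "real ^ 'n ^ 'n \<Rightarrow> real ^ 'n ^ 'n" where
  "matrix_sqrt S = (THE R. transpose R = R \<and> positive_definite R \<and> R ** R = S)"

definition symmetric_part :: "real ^ 'n ^ 'n \<Rightarrow> real ^ 'n ^ 'n" where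
  "symmetric_part P = (1 / 2) *\<^sub>R (P + transpose P)"

definition eta_squared :: "real ^ 'n ^ 'n \<Rightarrow> real" where
  "eta_squared P =
     (let S = symmetric_part P; H = matrix_inv (matrix_sqrt S)
      in max_eigenvalue (H ** transpose P ** matrix_inv S ** P ** H))"

end

theory Submission
  imports Defs
begin

text \<open>
  A Wardrop equilibrium \<open>z\<close> satisfies \<open>C(z) \<le> \<langle>c(z), w\<rangle>\<close> for every feasible \<open>w\<close>, so it remains to
  bound \<open>\<langle>Qz, w\<rangle> + \<langle>Pz, w\<rangle>\<close>.

  For (a), put \<open>q(z) = \<langle>Qz, z\<rangle>\<close> and \<open>p(z) = \<langle>Pz, z\<rangle>\<close>. Then
  \<open>\<langle>Qz, w\<rangle> \<le> \<lambda> q(z) + k / (4\<lambda>) q(w)\<close>, and Cauchy-Schwarz for the inner product given by \<open>S\<close> yields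
  \<open>\<langle>Pz, w\<rangle> \<le> \<lambda> p(z) + \<eta>\<^sup>2 / (4\<lambda>) p(w)\<close>. The choices are \<open>\<lambda> = k/4\<close> if \<open>\<eta>\<^sup>2 \<le> k\<close>, \<open>\<lambda> = \<eta>\<^sup>2/4\<close> if
  \<open>k < \<eta>\<^sup>2 < 2\<close>, and \<open>\<lambda> = 1/2\<close> otherwise.

  For (b), scaling \<open>w\<close> down makes it feasible, so \<open>(2 + k/4) C(z) \<le> \<langle>c(z), w\<rangle>\<close>. As \<open>A\<close> is
  entrywise nonnegative, \<open>\<langle>Az, w\<rangle> \<le> \<langle>Az, w\<rangle> + \<langle>Aw, z\<rangle>\<close>, and this symmetric expression is at most
  \<open>(1 + k/4) \<langle>Az, z\<rangle> + \<langle>Aw, w\<rangle>\<close>: for \<open>P\<close> because \<open>\<langle>P(z - w), z - w\<rangle> \<ge> 0\<close>, for \<open>Q\<close> block by block.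
\<close>

section \<open>Symmetric matrices and the constant eta\<close>

text \<open>Arithmetic-geometric mean inequality. It turns a Cauchy-Schwarz bound on a square into a
  weighted sum whose weight \<lambda> stays free, since \<open>X\<close> and \<open>Y\<close> may be
  rescaled inversely.\<close>

lemma le_add_of_square_le:
  fixes c X Y :: real
  assumes "c\<^sup>2 \<le> 4 * X * Y" "X \<ge> 0" "Y \<ge> 0"
  shows "c \<le> X + Y"
proof (rule power2_le_imp_le)
  have "4 * X * Y \<le> (X + Y)\<^sup>2"
    using zero_le_power2[of "X - Y"] by (simp add: power2_eq_square algebra_simps)
  with assms(1) show "c\<^sup>2 \<le> (X + Y)\<^sup>2" by linarith
qed (use assms in simp)

section \<open>The spectral theorem for symmetric maps\<close>

text \<open>Maximising \<open>x \<bullet> f x\<close> over the unit sphere of \<open>V\<close>,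
  which is compact, yields \<open>v\<close>. It is an eigenvector by the first-order condition at
  the maximum, taken in the direction \<open>g v\<close>.\<close>

lemma symmetric_top_eigenvector:
  fixes f :: "'a::euclidean_space \<Rightarrow> 'a"
  assumes lin: "linear f" and sym: "\<And>x y. f x \<bullet> y = x \<bullet> f y"
    and V: "subspace V" "f ` V \<subseteq> V" "V \<noteq> {0}"
  obtains v where "v \<in> V" "norm v = 1" "f v = (v \<bullet> f v) *\<^sub>R v"
    "\<And>x. x \<in> V \<Longrightarrow> x \<bullet> f x \<le> (v \<bullet> f v) * (x \<bullet> x)"
proof -
  let ?S = "V \<inter> sphere 0 1"
  obtain u where u: "u \<in> V" "u \<noteq> 0"
    using V subspace_0 by blast
  have "(1 / norm u) *\<^sub>R u \<in> ?S"
    using u V(1) by (auto intro: subspace_scale)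
  then have ne: "?S \<noteq> {}" by blast
  have comp: "compact ?S"
    by (intro closed_Int_compact closed_subspace V(1)) simp
  have cont: "continuous_on ?S (\<lambda>x. x \<bullet> f x)"
    by (intro continuous_intros linear_continuous_on linear_conv_bounded_linear[THEN iffD1] lin)
  obtain v where v: "v \<in> ?S" "\<And>y. y \<in> ?S \<Longrightarrow> y \<bullet> f y \<le> v \<bullet> f v"
    using continuous_attains_sup[OF comp ne cont] by auto
  define l where "l = v \<bullet> f v"
  have le: "x \<bullet> f x \<le> l * (x \<bullet> x)" if "x \<in> V" for x
  proof (cases "x = 0")
    case False
    have "(1 / norm x) *\<^sub>R x \<in> ?S"
      using False that V(1) by (auto intro: subspace_scale)
    from v(2)[OF this] have "(x \<bullet> f x) / (norm x)\<^sup>2 \<le> l"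
      by (simp add: l_def linear_scale[OF lin] power2_eq_square)
    then show ?thesis
      using False by (simp add: divide_simps power2_norm_eq_inner mult.commute split: if_splits)
  qed (simp add: linear_0[OF lin])
  define g where "g x = l *\<^sub>R x - f x" for x
  have vV: "v \<in> V" and vv: "v \<bullet> v = 1" using v(1) by (auto simp: norm_eq_1)
  have gV: "g v \<in> V"
    unfolding g_def using V vV by (auto intro: subspace_diff subspace_scale)
  define N c where "N = g v \<bullet> g v" and "c = g v \<bullet> g (g v)"
  have c0: "0 \<le> c"
    using le[OF gV] by (simp add: c_def g_def[of "g v"] inner_diff_right)
  \<comment> \<open>\<open>l\<close> is the maximum, so the form of \<open>g\<close> is nonnegative
    on \<open>V\<close> and vanishes at \<open>v\<close>. At \<open>v + t g(v)\<close> it therefore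
    has no constant term, which forces the linear coefficient \<open>2 * N\<close> to be
    zero.\<close>
  have quad: "0 \<le> 2 * t * N + t\<^sup>2 * c" for t
  proof -
    let ?x = "v + t *\<^sub>R g v"
    have "?x \<in> V" using V(1) vV gV by (intro subspace_add subspace_scale)
    from le[OF this] have "0 \<le> ?x \<bullet> g ?x"
      by (simp add: g_def[of ?x] inner_diff_right)
    also have "g ?x = g v + t *\<^sub>R g (g v)"
      by (simp add: g_def linear_add[OF lin] linear_scale[OF lin] linear_diff[OF lin] algebra_simps)
    also have "?x \<bullet> \<dots> = v \<bullet> g v + t * N + t * (v \<bullet> g (g v)) + t\<^sup>2 * c"
      by (simp add: N_def c_def inner_add_left inner_add_right power2_eq_square algebra_simps)
    also have "v \<bullet> g v = 0"
      using vv by (simp add: g_def l_def inner_diff_right)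
    also have "v \<bullet> g (g v) = N"
      unfolding N_def g_def[of "g v"] by (simp add: inner_diff_right sym[symmetric])
        (simp add: g_def inner_diff_left inner_diff_right inner_commute algebra_simps)
    finally show ?thesis by (simp add: algebra_simps)
  qed
  have "N = 0"
  proof (rule ccontr)
    assume "N \<noteq> 0"
    then have N: "N > 0" by (simp add: N_def)
    \<comment> \<open>A small negative \<open>t\<close> makes the linear term dominate; the
      \<open>+ 1\<close> keeps the denominator positive when \<open>c = 0\<close>.\<close>
    have "0 \<le> (N / (c + 1)) * (- 2 * N + N * c / (c + 1))"
      using quad[of "- N / (c + 1)"] by (simp add: power2_eq_square algebra_simps)
    moreover have "0 < N / (c + 1)" using N c0 by simp
    ultimately have "0 \<le> - 2 * N + N * c / (c + 1)"
      using zero_le_mult_iff not_le by metis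
    moreover have "N * c / (c + 1) \<le> N"
      using N c0 by (simp add: divide_simps)
    ultimately show False using N by linarith
  qed
  then have "f v = l *\<^sub>R v" by (simp add: N_def g_def)
  moreover have "norm v = 1" using v(1) by simp
  ultimately show ?thesis
    using that[OF vV] le unfolding l_def by blast
qed

text \<open>Induction on the dimension: an eigenvector \<open>v\<close> is split off, and symmetry
  of \<open>f\<close> makes its orthogonal complement in \<open>V\<close> invariant. Completeness is
  stated as an expansion, ready for comparing linear maps on basis vectors.\<close>

lemma symmetric_orthonormal_eigenbasis:
  fixes f :: "'a::euclidean_space \<Rightarrow> 'a"
  assumes lin: "linear f" and sym: "\<And>x y. f x \<bullet> y = x \<bullet> f y"
    and "subspace V" "f ` V \<subseteq> V"
  shows "\<exists>B. finite B \<and> B \<subseteq> V \<and> pairwise orthogonal B \<and>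
    (\<forall>b\<in>B. norm b = 1 \<and> f b = (b \<bullet> f b) *\<^sub>R b) \<and>
    (\<forall>x\<in>V. x = (\<Sum>b\<in>B. (x \<bullet> b) *\<^sub>R b))"
  using assms(3,4)
proof (induction "dim V" arbitrary: V rule: less_induct)
  case less
  show ?case
  proof (cases "V = {0}")
    case True
    then show ?thesis by (intro exI[of _ "{}"]) auto
  next
    case False
    obtain v where v: "v \<in> V" "norm v = 1" "f v = (v \<bullet> f v) *\<^sub>R v"
      using symmetric_top_eigenvector[OF lin sym less.prems False] by blast
    define W where "W = {x \<in> V. v \<bullet> x = 0}"
    have sW: "subspace W"
      using less.prems(1) unfolding W_def subspace_def by (auto simp: inner_add_right)
    have fW: "f ` W \<subseteq> W"
    proof
      fix y assume "y \<in> f ` W"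
      then obtain x where x: "x \<in> V" "v \<bullet> x = 0" "y = f x" by (auto simp: W_def)
      have "v \<bullet> f x = (v \<bullet> f v) * (v \<bullet> x)"
        by (metis sym v(3) inner_scaleR_left)
      then show "y \<in> W" using x less.prems(2) by (auto simp: W_def)
    qed
    have vv: "v \<bullet> v = 1" using v(2) by (simp add: norm_eq_1)
    have "v \<notin> W" using vv by (simp add: W_def)
    moreover have "W \<subseteq> V" by (auto simp: W_def)
    ultimately have "W \<subset> V" using v(1) by blast
    then have "dim W < dim V"
      using sW less.prems(1) by (metis dim_psubset span_eq_iff)
    from less.hyps[OF this sW fW] obtain B where B: "finite B" "B \<subseteq> W" "pairwise orthogonal B"
      "\<And>b. b \<in> B \<Longrightarrow> norm b = 1 \<and> f b = (b \<bullet> f b) *\<^sub>R b"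
      "\<And>x. x \<in> W \<Longrightarrow> x = (\<Sum>b\<in>B. (x \<bullet> b) *\<^sub>R b)"
      by blast
    have vB: "v \<bullet> b = 0" if "b \<in> B" for b using B(2) that by (auto simp: W_def)
    then have nB: "v \<notin> B" using vv by fastforce
    show ?thesis
    proof (intro exI[of _ "insert v B"] conjI ballI)
      show "pairwise orthogonal (insert v B)"
        using B(3) vB by (auto simp: pairwise_insert orthogonal_def inner_commute)
      fix x assume x: "x \<in> V"
      define y where "y = x - (x \<bullet> v) *\<^sub>R v"
      have "y \<in> W"
        using x v(1) vv less.prems(1)
        by (auto simp: y_def W_def inner_diff_right inner_commute intro: subspace_diff subspace_scale)
      then have "y = (\<Sum>b\<in>B. (y \<bullet> b) *\<^sub>R b)" by (rule B(5))
      also have "\<dots> = (\<Sum>b\<in>B. (x \<bullet> b) *\<^sub>R b)"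
        by (intro sum.cong) (auto simp: y_def inner_diff_left vB)
      finally show "x = (\<Sum>b\<in>insert v B. (x \<bullet> b) *\<^sub>R b)"
        using B(1) nB by (simp add: y_def algebra_simps)
    qed (use B v in \<open>auto simp: W_def\<close>)
  qed
qed

section \<open>Positive definite square roots and inverses\<close>

lemma inner_transpose_matrix:
  fixes M :: "real ^ 'n ^ 'n"
  shows "(transpose M *v x) \<bullet> y = x \<bullet> (M *v y)"
  by (metis dot_lmul_matrix vector_transpose_matrix transpose_transpose)

lemma symmetric_matrix_eqI:
  fixes M :: "real ^ 'n ^ 'n"
  assumes "\<And>x y. (M *v x) \<bullet> y = x \<bullet> (M *v y)"
  shows "transpose M = M"
proof -
  have "transpose M *v x = M *v x" for x
    by (rule vector_eq_rdot[THEN iffD1]) (simp add: dot_lmul_matrix assms)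
  then show ?thesis by (simp add: matrix_eq)
qed

text \<open>\<open>R\<close> has the eigenbasis of \<open>S\<close> and the square roots of its
  eigenvalues, which are positive.\<close>

lemma matrix_sqrt_exists:
  fixes S :: "real ^ 'n ^ 'n"
  assumes S: "transpose S = S" "positive_definite S"
  shows "\<exists>R. transpose R = R \<and> positive_definite R \<and> R ** R = S"
proof -
  have sym: "(S *v x) \<bullet> y = x \<bullet> (S *v y)" for x y
    using inner_transpose_matrix[of S] S(1) by simp
  obtain B where B: "finite B" "pairwise orthogonal B"
      "\<And>b. b \<in> B \<Longrightarrow> norm b = 1" "\<And>b. b \<in> B \<Longrightarrow> S *v b = (b \<bullet> (S *v b)) *\<^sub>R b"
      "\<And>x. x = (\<Sum>b\<in>B. (x \<bullet> b) *\<^sub>R b)"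
    using symmetric_orthonormal_eigenbasis[of "(*v) S" UNIV] sym by auto
  have ortho: "b \<bullet> b' = (if b = b' then 1 else 0)" if "b \<in> B" "b' \<in> B" for b b'
    using B(2,3) that by (auto simp: pairwise_def orthogonal_def norm_eq_1)
  define l where "l b = b \<bullet> (S *v b)" for b
  have Sb: "S *v b = l b *\<^sub>R b" if "b \<in> B" for b
    unfolding l_def by (rule B(4)[OF that])
  have lpos: "l b > 0" if "b \<in> B" for b
  proof -
    have "b \<noteq> 0" using B(3)[OF that] by force
    then show ?thesis using S(2) by (simp add: positive_definite_def l_def)
  qed
  define f where "f x = (\<Sum>b\<in>B. (sqrt (l b) * (x \<bullet> b)) *\<^sub>R b)" for x
  have lin: "linear f"
    by (rule linearI)
      (simp_all add: f_def inner_add_left sum.distrib[symmetric] scaleR_sum_right algebra_simps)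
  have fin: "f x \<bullet> y = (\<Sum>b\<in>B. sqrt (l b) * (x \<bullet> b) * (y \<bullet> b))" for x y
    by (simp add: f_def inner_sum_left inner_commute[of y])
  define R where "R = matrix f"
  have R: "R *v x = f x" for x using lin by (simp add: R_def matrix_works linear_matrix_vector_mul_eq)
  have "transpose R = R"
    by (rule symmetric_matrix_eqI) (simp add: R fin inner_commute[of _ "f _"] mult_ac)
  moreover have "positive_definite R"
    unfolding positive_definite_def
  proof (intro allI impI)
    fix x :: "real ^ 'n" assume "x \<noteq> 0"
    then obtain b where b: "b \<in> B" "x \<bullet> b \<noteq> 0"
      using B(5)[of x] by (metis (no_types, lifting) scale_eq_0_iff sum.neutral)
    have "0 < (\<Sum>b\<in>B. sqrt (l b) * (x \<bullet> b) * (x \<bullet> b))"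
    proof (rule sum_pos2[OF B(1) b(1)])
      show "0 < sqrt (l b) * (x \<bullet> b) * (x \<bullet> b)"
        using lpos[OF b(1)] b(2) by (simp add: mult.assoc not_sum_power2_lt_zero zero_less_mult_iff)
           (metis linorder_neqE_linordered_idom)
      fix i assume "i \<in> B"
      then show "0 \<le> sqrt (l i) * (x \<bullet> i) * (x \<bullet> i)"
        using lpos[of i] by (simp add: mult.assoc)
    qed
    then show "x \<bullet> (R *v x) > 0" by (simp add: R inner_commute[of x] fin)
  qed
  moreover have "R ** R = S"
  proof -
    have fb: "f b = sqrt (l b) *\<^sub>R b" if "b \<in> B" for b
    proof -
      have "f b = (\<Sum>b'\<in>B. if b = b' then sqrt (l b) *\<^sub>R b else 0)"
        unfolding f_def using that by (intro sum.cong) (auto simp: ortho)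
      then show ?thesis using that B(1) by simp
    qed
    have "f (f x) = S *v x" for x
    proof -
      have "f (f x) = (\<Sum>b\<in>B. (x \<bullet> b) *\<^sub>R f (f b))"
        by (subst B(5)[of x]) (simp add: linear_sum[OF lin] linear_scale[OF lin])
      also have "\<dots> = (\<Sum>b\<in>B. (x \<bullet> b) *\<^sub>R (S *v b))"
        using lpos by (intro sum.cong)
          (auto simp: fb linear_scale[OF lin] Sb less_imp_le)
      also have "\<dots> = S *v (\<Sum>b\<in>B. (x \<bullet> b) *\<^sub>R b)"
        by (simp add: linear_sum[OF matrix_vector_mul_linear] matrix_vector_mult_scaleR)
      finally show ?thesis using B(5)[of x] by simp
    qed
    then show ?thesis
      by (simp add: matrix_eq R matrix_vector_mul_assoc[symmetric])
  qed
  ultimately show ?thesis by blast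
qed

text \<open>
  With \<open>D = R - R'\<close> one has \<open>R D + D R' = R\<^sup>2 - R'\<^sup>2 = 0\<close>, so an eigenvector \<open>v\<close> of \<open>D\<close> with
  eigenvalue \<open>\<mu>\<close> gives \<open>\<mu> (v\<^sup>T R v + v\<^sup>T R' v) = 0\<close>.
\<close>

lemma matrix_sqrt_unique:
  fixes R R' :: "real ^ 'n ^ 'n"
  assumes R: "transpose R = R" "positive_definite R"
    and R': "transpose R' = R'" "positive_definite R'"
    and eq: "R ** R = R' ** R'"
  shows "R = R'"
proof -
  let ?D = "\<lambda>x. R *v x - R' *v x"
  have symR: "(R *v x) \<bullet> y = x \<bullet> (R *v y)" for x y
    using inner_transpose_matrix[of R] R(1) by simp
  have symR': "(R' *v x) \<bullet> y = x \<bullet> (R' *v y)" for x y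
    using inner_transpose_matrix[of R'] R'(1) by simp
  have lin: "linear ?D" by (intro linear_compose_sub matrix_vector_mul_linear)
  have sym: "?D x \<bullet> y = x \<bullet> ?D y" for x y
    by (simp add: inner_diff_left inner_diff_right symR symR')
  have zero: "\<mu> = 0" if v: "v \<noteq> 0" "?D v = \<mu> *\<^sub>R v" for v \<mu>
  proof -
    have "R *v (?D v) + ?D (R' *v v) = 0"
      using eq by (simp add: matrix_vector_mult_diff_distrib matrix_vector_mul_assoc)
    then have "0 = v \<bullet> (R *v (?D v)) + v \<bullet> ?D (R' *v v)"
      by (metis inner_add_right inner_zero_right)
    also have "v \<bullet> (R *v (?D v)) = \<mu> * (v \<bullet> (R *v v))"
      unfolding v(2) by (simp add: matrix_vector_mult_scaleR)
    also have "v \<bullet> ?D (R' *v v) = \<mu> * (v \<bullet> (R' *v v))"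
      unfolding sym[symmetric] v(2) by simp
    finally have "\<mu> * (v \<bullet> (R *v v) + v \<bullet> (R' *v v)) = 0" by (simp add: algebra_simps)
    moreover have "v \<bullet> (R *v v) + v \<bullet> (R' *v v) > 0"
      using R(2) R'(2) v(1) by (simp add: positive_definite_def add_pos_pos)
    ultimately show ?thesis by simp
  qed
  \<comment> \<open>\<open>?D\<close> is symmetric, so it has an eigenbasis; all its eigenvalues
    being 0, it vanishes.\<close>
  obtain B where B: "finite B" "\<And>b. b \<in> B \<Longrightarrow> norm b = 1"
      "\<And>b. b \<in> B \<Longrightarrow> ?D b = (b \<bullet> ?D b) *\<^sub>R b"
      "\<And>x. x = (\<Sum>b\<in>B. (x \<bullet> b) *\<^sub>R b)"
    using symmetric_orthonormal_eigenbasis[OF lin sym, of UNIV] by auto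
  have "?D b = 0" if "b \<in> B" for b
    using zero[OF _ B(3)[OF that]] B(2)[OF that] B(3)[OF that]
    by (metis norm_zero scaleR_zero_left zero_neq_one)
  then have D0: "?D (\<Sum>b\<in>B. (x \<bullet> b) *\<^sub>R b) = 0" for x
    by (simp add: linear_sum[OF lin] linear_scale[OF lin])
  have "?D x = 0" for x
    by (rule D0[of x, folded B(4)[of x]])
  then show ?thesis by (simp add: matrix_eq)
qed

text \<open>Existence and uniqueness together resolve the definite description in
  \<open>matrix_sqrt\<close>.\<close>

lemma matrix_sqrt:
  fixes S :: "real ^ 'n ^ 'n"
  assumes "transpose S = S" "positive_definite S"
  shows "transpose (matrix_sqrt S) = matrix_sqrt S" "positive_definite (matrix_sqrt S)"
    "matrix_sqrt S ** matrix_sqrt S = S"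
proof -
  have "\<exists>!R. transpose R = R \<and> positive_definite R \<and> R ** R = S"
    using matrix_sqrt_exists[OF assms] matrix_sqrt_unique by (metis (no_types, lifting))
  from theI'[OF this] show "transpose (matrix_sqrt S) = matrix_sqrt S"
    "positive_definite (matrix_sqrt S)" "matrix_sqrt S ** matrix_sqrt S = S"
    unfolding matrix_sqrt_def by blast+
qed

lemma positive_definite_invertible:
  fixes M :: "real ^ 'n ^ 'n"
  assumes "positive_definite M"
  shows "invertible M"
proof -
  have "x = 0" if "M *v x = 0" for x
    using assms that by (force simp: positive_definite_def)
  then show ?thesis
    by (simp add: invertible_left_inverse matrix_left_invertible_ker)
qed

lemma invertible_matrix_inv:
  assumes "invertible M"
  shows "M ** matrix_inv M = mat 1" "matrix_inv M ** M = mat 1"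
  using someI_ex[OF assms[unfolded invertible_def]] by (simp_all add: matrix_inv_def)

section \<open>The largest eigenvalue and the constant eta\<close>

text \<open>The maximum of the form on the unit sphere is itself an eigenvalue and bounds every
  other one, so the \<open>GREATEST\<close> in \<open>max_eigenvalue\<close> is attained
  there.\<close>

lemma inner_le_max_eigenvalue:
  fixes M :: "real ^ 'n ^ 'n"
  assumes "transpose M = M"
  shows "x \<bullet> (M *v x) \<le> max_eigenvalue M * (x \<bullet> x)"
proof -
  have sym: "(M *v x) \<bullet> y = x \<bullet> (M *v y)" for x y
    using inner_transpose_matrix[of M] assms by simp
  have "(UNIV :: (real ^ 'n) set) \<noteq> {0}"
    using UNIV_not_singleton by blast
  then obtain v where v: "norm v = 1" "M *v v = (v \<bullet> (M *v v)) *\<^sub>R v"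
    "\<And>x. x \<bullet> (M *v x) \<le> (v \<bullet> (M *v v)) * (x \<bullet> x)"
    using symmetric_top_eigenvector[of "(*v) M" UNIV] sym by auto
  have "max_eigenvalue M = v \<bullet> (M *v v)"
    unfolding max_eigenvalue_def
  proof (rule Greatest_equality)
    show "\<exists>u. u \<noteq> 0 \<and> M *v u = (v \<bullet> (M *v v)) *\<^sub>R u"
      using v(1,2) by (metis norm_zero zero_neq_one)
    fix \<mu> assume "\<exists>u. u \<noteq> 0 \<and> M *v u = \<mu> *\<^sub>R u"
    then obtain u where u: "u \<noteq> 0" "M *v u = \<mu> *\<^sub>R u" by blast
    then show "\<mu> \<le> v \<bullet> (M *v v)"
      using v(3)[of u] by simp
  qed
  with v(3) show ?thesis by simp
qed

text \<open>With \<open>R\<close> the square root of \<open>S\<close> and \<open>H\<close> its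
  inverse, \<open>w \<bullet> P z = (R w) \<bullet> (H P z)\<close>, and Cauchy-Schwarz applies. The
  squared norm of \<open>R w\<close> is \<open>w \<bullet> P w\<close>; that of \<open>H P z\<close>
  is the form of the matrix defining eta, evaluated at \<open>R z\<close>.\<close>

lemma eta_squared_bound:
  fixes P :: "real ^ 'n ^ 'n"
  assumes P: "positive_definite P"
  shows "(w \<bullet> (P *v z))\<^sup>2 \<le> eta_squared P * (z \<bullet> (P *v z)) * (w \<bullet> (P *v w))"
proof -
  define S where "S = symmetric_part P"
  \<comment> \<open>The antisymmetric part of \<open>P\<close> contributes nothing to the quadratic
    form.\<close>
  have Sq: "x \<bullet> (S *v x) = x \<bullet> (P *v x)" for x
  proof -
    have "x \<bullet> (transpose P *v x) = x \<bullet> (P *v x)"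
      by (metis inner_commute inner_transpose_matrix)
    then show ?thesis
      by (simp add: S_def symmetric_part_def scaleR_matrix_vector_assoc[symmetric]
          matrix_vector_mult_add_rdistrib inner_add_right)
  qed
  have S: "transpose S = S" "positive_definite S"
    using P by (simp_all add: positive_definite_def Sq)
      (simp add: S_def symmetric_part_def transpose_def vec_eq_iff add.commute)
  define R H where "R = matrix_sqrt S" and "H = matrix_inv R"
  note R = matrix_sqrt[OF S, folded R_def]
  have inv: "H ** R = mat 1" "R ** H = mat 1"
    using positive_definite_invertible[OF R(2)] by (simp_all add: H_def invertible_matrix_inv)
  have Ht: "transpose H = H"
    by (metis R(1) inv matrix_left_right_inverse matrix_mul_assoc matrix_mul_lid matrix_mul_rid
        matrix_transpose_mul transpose_mat)
  \<comment> \<open>\<open>H ** H\<close> is a two-sided inverse of \<open>S\<close>, hence equal to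
    \<open>matrix_inv S\<close>. Thus \<open>M\<close> below is the transpose of
    \<open>H ** P ** H\<close> times \<open>H ** P ** H\<close>, in particular symmetric.\<close>
  have "S ** (H ** H) = mat 1" "(H ** H) ** S = mat 1"
    unfolding R(3)[symmetric] using inv by (metis matrix_mul_assoc matrix_mul_rid)+
  moreover have "S ** matrix_inv S = mat 1"
    using positive_definite_invertible[OF S(2)] by (simp add: invertible_matrix_inv)
  ultimately have Si: "matrix_inv S = H ** H"
    by (metis matrix_mul_assoc matrix_mul_lid matrix_mul_rid)
  have symR: "(R *v x) \<bullet> y = x \<bullet> (R *v y)" for x y
    using inner_transpose_matrix[of R] R(1) by simp
  have symH: "(H *v x) \<bullet> y = x \<bullet> (H *v y)" for x y
    using inner_transpose_matrix[of H] Ht by simp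
  have HR: "H *v (R *v x) = x" "R *v (H *v x) = x" for x
    by (simp_all add: matrix_vector_mul_assoc inv)
  have normR: "(R *v x) \<bullet> (R *v x) = x \<bullet> (P *v x)" for x
    by (simp add: symR matrix_vector_mul_assoc R(3) Sq)
  define M where "M = H ** transpose P ** matrix_inv S ** P ** H"
  have Mt: "transpose M = M"
    by (simp add: M_def Si matrix_transpose_mul Ht matrix_mul_assoc)
  have MRz: "(R *v z) \<bullet> (M *v (R *v z)) = (H *v (P *v z)) \<bullet> (H *v (P *v z))"
  proof -
    have "M *v (R *v z) = H *v (transpose P *v (H *v (H *v (P *v z))))"
      by (simp add: M_def Si matrix_vector_mul_assoc[symmetric] HR)
    then have "(R *v z) \<bullet> (M *v (R *v z)) = z \<bullet> (transpose P *v (H *v (H *v (P *v z))))"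
      by (simp only: symH[symmetric] HR)
    also have "\<dots> = (H *v (H *v (P *v z))) \<bullet> (P *v z)"
      by (subst inner_commute) (rule inner_transpose_matrix)
    finally show ?thesis by (simp only: symH)
  qed
  have eta: "(H *v (P *v z)) \<bullet> (H *v (P *v z)) \<le> eta_squared P * (z \<bullet> (P *v z))"
    using inner_le_max_eigenvalue[OF Mt, of "R *v z"]
    unfolding MRz normR
    by (simp add: eta_squared_def Let_def M_def H_def R_def S_def)
  have "w \<bullet> (P *v z) = (R *v w) \<bullet> (H *v (P *v z))"
    by (simp add: symR HR)
  then have "(w \<bullet> (P *v z))\<^sup>2 \<le> (w \<bullet> (P *v w)) * ((H *v (P *v z)) \<bullet> (H *v (P *v z)))"
    using Cauchy_Schwarz_ineq[of "R *v w" "H *v (P *v z)"] by (simp add: normR)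
  also have "\<dots> \<le> (w \<bullet> (P *v w)) * (eta_squared P * (z \<bullet> (P *v z)))"
    using eta by (rule mult_left_mono) (metis Sq normR inner_ge_zero)
  finally show ?thesis by (simp add: mult_ac)
qed

section \<open>Routings and equilibria\<close>

lemma scale_players_simps [simp]:
  "od_paths (scale_players p \<Gamma>) j = od_paths \<Gamma> j"
  "pairs (scale_players p \<Gamma>) = pairs \<Gamma>"
  "mass (scale_players p \<Gamma>) j t = p * mass \<Gamma> j t"
  "social_cost (scale_players p \<Gamma>) = social_cost \<Gamma>"
  "induced_routing (scale_players p \<Gamma>) = induced_routing \<Gamma>"
  by (simp_all add: scale_players_def od_paths_def social_cost_def cost_def induced_routing_def fun_eq_iff)

text \<open>Path flows can be divided by \<open>p\<close>. This lets (b) compare the equilibrium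
  with routings of the larger game.\<close>

lemma feasible_routing_scale_players:
  assumes "w \<in> feasible_routings (scale_players p \<Gamma>)" "p > 0"
  shows "(1 / p) *\<^sub>R w \<in> feasible_routings \<Gamma>"
proof -
  obtain f where f: "feasible_path_flow (scale_players p \<Gamma>) f" "w = induced_routing \<Gamma> f"
    using assms(1) by (auto simp: feasible_routings_def)
  define g where "g j t q = f j t q / p" for j t q
  have "feasible_path_flow \<Gamma> g"
    using f(1) assms(2)
    by (auto simp: feasible_path_flow_def g_def sum_divide_distrib[symmetric])
  moreover have "(1 / p) *\<^sub>R w = induced_routing \<Gamma> g"
    by (simp add: f(2) induced_routing_def vec_eq_iff g_def sum_divide_distrib)
  ultimately show ?thesis by (auto simp: feasible_routings_def)
qed

lemma feasible_routing_nonneg: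
  assumes "w \<in> feasible_routings \<Gamma>"
  shows "w $ r \<ge> 0"
  using assms by (auto simp: feasible_routings_def feasible_path_flow_def induced_routing_def
      intro!: sum_nonneg)

lemma finite_od_paths:
  assumes "mixed_autonomy_game \<Gamma>"
  shows "finite (od_paths \<Gamma> j)"
  using assms by (simp add: mixed_autonomy_game_def od_paths_def fin_digraph.apaths_finite)

text \<open>A repeated arc would make its tail appear twice among the visited vertices.\<close>

lemma (in pre_digraph) distinct_awalk_verts_imp_distinct:
  "distinct (awalk_verts u p) \<Longrightarrow> distinct p"
proof (induction p arbitrary: u)
  case (Cons e p)
  have "tail G e' \<in> set (awalk_verts x q)" if "e' \<in> set q" for e' x q
    using that by (induction q arbitrary: x) auto
  then show ?case using Cons by auto
qed simp

lemma od_path_distinct: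
  assumes "p \<in> od_paths \<Gamma> j"
  shows "distinct p"
  using assms by (auto simp: od_paths_def pre_digraph.apath_def
      intro: pre_digraph.distinct_awalk_verts_imp_distinct)

text \<open>Summation over roads is exchanged with summation over paths; a path repeats no road, so
  its list sum is a sum over a set. For \<open>v = cost \<Gamma> z\<close> the inner sum is the path
  delay.\<close>

lemma inner_induced_routing:
  assumes "mixed_autonomy_game \<Gamma>"
  shows "v \<bullet> induced_routing \<Gamma> f =
    (\<Sum>j<pairs \<Gamma>. \<Sum>t\<in>UNIV. \<Sum>p\<in>od_paths \<Gamma> j. f j t p * (\<Sum>i\<leftarrow>p. v $ (i, t)))"
proof -
  have path: "(\<Sum>i\<leftarrow>p. v $ (i, t)) = (\<Sum>i\<in>UNIV. if i \<in> set p then v $ (i, t) else 0)"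
    if "p \<in> od_paths \<Gamma> j" for p j t
    using od_path_distinct[OF that] by (simp add: sum_list_distinct_conv_sum_set sum.If_cases)
  have "v \<bullet> induced_routing \<Gamma> f =
      (\<Sum>i\<in>UNIV. \<Sum>t\<in>UNIV. v $ (i, t) *
        (\<Sum>j<pairs \<Gamma>. \<Sum>p\<in>od_paths \<Gamma> j. if i \<in> set p then f j t p else 0))"
    by (simp add: inner_vec_def induced_routing_def UNIV_Times_UNIV[symmetric] sum.cartesian_product
        case_prod_beta sum.inter_filter finite_od_paths[OF assms] del: UNIV_Times_UNIV)
  also have "\<dots> = (\<Sum>i\<in>UNIV. \<Sum>t\<in>UNIV. \<Sum>j<pairs \<Gamma>. \<Sum>p\<in>od_paths \<Gamma> j.
      f j t p * (if i \<in> set p then v $ (i, t) else 0))"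
    by (auto simp: sum_distrib_left intro!: sum.cong)
  also have "\<dots> = (\<Sum>j<pairs \<Gamma>. \<Sum>t\<in>UNIV. \<Sum>p\<in>od_paths \<Gamma> j. \<Sum>i\<in>UNIV.
      f j t p * (if i \<in> set p then v $ (i, t) else 0))"
  proof -
    \<comment> \<open>Four adjacent swaps move the sum over roads innermost. The set of paths
      depends on the pair, so the pair index stays outside the path index.\<close>
    have "(\<Sum>i\<in>I. \<Sum>t\<in>T. \<Sum>j\<in>J. \<Sum>p\<in>L j. F i t j p) = (\<Sum>j\<in>J. \<Sum>t\<in>T. \<Sum>p\<in>L j. \<Sum>i\<in>I. F i t j p)"
      for I T J L and F :: "_ \<Rightarrow> _ \<Rightarrow> _ \<Rightarrow> _ \<Rightarrow> real"
    proof -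
      have "(\<Sum>i\<in>I. \<Sum>t\<in>T. \<Sum>j\<in>J. \<Sum>p\<in>L j. F i t j p) = (\<Sum>i\<in>I. \<Sum>j\<in>J. \<Sum>t\<in>T. \<Sum>p\<in>L j. F i t j p)"
        by (rule sum.cong[OF refl]) (rule sum.swap)
      also have "\<dots> = (\<Sum>j\<in>J. \<Sum>i\<in>I. \<Sum>t\<in>T. \<Sum>p\<in>L j. F i t j p)"
        by (rule sum.swap)
      also have "\<dots> = (\<Sum>j\<in>J. \<Sum>t\<in>T. \<Sum>i\<in>I. \<Sum>p\<in>L j. F i t j p)"
        by (rule sum.cong[OF refl]) (rule sum.swap)
      also have "\<dots> = (\<Sum>j\<in>J. \<Sum>t\<in>T. \<Sum>p\<in>L j. \<Sum>i\<in>I. F i t j p)"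
        by (rule sum.cong[OF refl], rule sum.cong[OF refl]) (rule sum.swap)
      finally show ?thesis .
    qed
    then show ?thesis .
  qed
  also have "\<dots> = (\<Sum>j<pairs \<Gamma>. \<Sum>t\<in>UNIV. \<Sum>p\<in>od_paths \<Gamma> j. f j t p * (\<Sum>i\<leftarrow>p. v $ (i, t)))"
    by (simp add: path sum_distrib_left[symmetric])
  finally show ?thesis .
qed

text \<open>The variational inequality, one pair and vehicle type at a time: the equilibrium uses
  only paths of least delay, and \<open>w\<close> distributes the same mass over paths that are at
  least as slow.\<close>

lemma wardrop_equilibrium_inner_le:
  assumes game: "mixed_autonomy_game \<Gamma>" and eq: "wardrop_equilibrium \<Gamma> z"
    and w: "w \<in> feasible_routings \<Gamma>"
  shows "cost \<Gamma> z \<bullet> z \<le> cost \<Gamma> z \<bullet> w"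
proof -
  obtain f where f: "feasible_path_flow \<Gamma> f" "z = induced_routing \<Gamma> f"
    "\<And>j t p q. \<lbrakk>j < pairs \<Gamma>; p \<in> od_paths \<Gamma> j; q \<in> od_paths \<Gamma> j; f j t p > 0\<rbrakk> \<Longrightarrow>
      (f j t q > 0 \<longrightarrow> path_delay \<Gamma> z t q = path_delay \<Gamma> z t p) \<and>
      (f j t q = 0 \<longrightarrow> \<not> path_delay \<Gamma> z t q < path_delay \<Gamma> z t p)"
    using eq unfolding wardrop_equilibrium_def by blast
  obtain g where g: "feasible_path_flow \<Gamma> g" "w = induced_routing \<Gamma> g"
    using w by (auto simp: feasible_routings_def)
  have "(\<Sum>p\<in>od_paths \<Gamma> j. f j t p * path_delay \<Gamma> z t p)
      \<le> (\<Sum>p\<in>od_paths \<Gamma> j. g j t p * path_delay \<Gamma> z t p)" if j: "j < pairs \<Gamma>" for j t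
  proof -
    let ?O = "od_paths \<Gamma> j" and ?d = "path_delay \<Gamma> z t"
    have fO: "f j t p \<ge> 0" and gO: "g j t p \<ge> 0" if "p \<in> ?O" for p
      using f(1) g(1) j that by (auto simp: feasible_path_flow_def)
    have mass: "sum (f j t) ?O = mass \<Gamma> j t" "sum (g j t) ?O = mass \<Gamma> j t"
      using f(1) g(1) j by (auto simp: feasible_path_flow_def)
    \<comment> \<open>\<open>D\<close> is the delay common to the paths used by \<open>f\<close>,
      which is minimal. If \<open>f\<close> uses none, the mass is zero, \<open>g\<close> vanishes
      as well and any \<open>D\<close> serves.\<close>
    have "\<exists>D. \<forall>p\<in>?O. f j t p * ?d p = f j t p * D \<and> g j t p * D \<le> g j t p * ?d p"
    proof (cases "\<exists>p\<in>?O. f j t p > 0")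
      case True
      then obtain p where p: "p \<in> ?O" "f j t p > 0" by blast
      have "f j t q * ?d q = f j t q * ?d p \<and> g j t q * ?d p \<le> g j t q * ?d q" if "q \<in> ?O" for q
        using f(3)[OF j p(1) that p(2)] fO[OF that] gO[OF that]
        by (cases "f j t q = 0") (auto intro!: mult_left_mono simp: not_less)
      then show ?thesis by blast
    next
      case False
      then have f0: "f j t p = 0" if "p \<in> ?O" for p using fO[OF that] that by force
      then have "sum (g j t) ?O = 0" using mass by simp
      then have "g j t p = 0" if "p \<in> ?O" for p
        using that gO finite_od_paths[OF game] by (simp add: sum_nonneg_eq_0_iff)
      with f0 show ?thesis by simp
    qed
    then obtain D where D: "\<And>p. p \<in> ?O \<Longrightarrow> f j t p * ?d p = f j t p * D"
      "\<And>p. p \<in> ?O \<Longrightarrow> g j t p * D \<le> g j t p * ?d p" by blast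
    have "(\<Sum>p\<in>?O. f j t p * ?d p) = (\<Sum>p\<in>?O. g j t p * D)"
      using mass by (simp add: D(1) sum_distrib_right[symmetric])
    also have "\<dots> \<le> (\<Sum>p\<in>?O. g j t p * ?d p)"
      by (rule sum_mono) (rule D(2))
    finally show ?thesis .
  qed
  then have "cost \<Gamma> z \<bullet> induced_routing \<Gamma> f \<le> cost \<Gamma> z \<bullet> induced_routing \<Gamma> g"
    unfolding inner_induced_routing[OF game] path_delay_def
    by (intro sum_mono[OF sum_mono]) simp
  with f(2) g(2) show ?thesis by simp
qed

section \<open>Block diagonal cost matrices\<close>

text \<open>The two rows of a block coincide, so both vehicle types get the same value on a road and
  the form becomes one product per road.\<close>

lemma inner_block_matrix:
  "w \<bullet> (block_matrix \<kappa> a *v z) =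
    (\<Sum>i\<in>UNIV. a i * ((\<kappa> i * z $ (i, Regular) + z $ (i, Smart)) * (w $ (i, Regular) + w $ (i, Smart))))"
proof -
  have Q: "(block_matrix \<kappa> a *v z) $ (i, t) = a i * (\<kappa> i * z $ (i, Regular) + z $ (i, Smart))" for i t
  proof -
    have "(block_matrix \<kappa> a *v z) $ (i, t) = (\<Sum>j\<in>UNIV. \<Sum>u\<in>UNIV.
        (if i = j then (case u of Regular \<Rightarrow> \<kappa> j * a j | Smart \<Rightarrow> a j) else 0) * z $ (j, u))"
      by (simp add: matrix_vector_mult_def block_matrix_def UNIV_Times_UNIV[symmetric]
          sum.cartesian_product case_prod_beta del: UNIV_Times_UNIV)
    also have "\<dots> = (\<Sum>j\<in>UNIV. if i = j then a j * (\<kappa> j * z $ (j, Regular) + z $ (j, Smart)) else 0)"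
      by (intro sum.cong) (auto simp: UNIV_vehicle algebra_simps)
    finally show ?thesis by simp
  qed
  have "w \<bullet> (block_matrix \<kappa> a *v z) = (\<Sum>i\<in>UNIV. \<Sum>t\<in>UNIV. w $ (i, t) * (block_matrix \<kappa> a *v z) $ (i, t))"
    by (simp add: inner_vec_def UNIV_Times_UNIV[symmetric] sum.cartesian_product case_prod_beta
        del: UNIV_Times_UNIV)
  also have "\<dots> = (\<Sum>i\<in>UNIV. a i * ((\<kappa> i * z $ (i, Regular) + z $ (i, Smart)) * (w $ (i, Regular) + w $ (i, Smart))))"
    by (simp add: Q UNIV_vehicle algebra_simps)
  finally show ?thesis .
qed

text \<open>The third bound holds because \<open>\<kappa> i\<close> and its reciprocal cannot both
  be below 1.\<close>

lemma max_asymmetry_bounds: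
  assumes "\<And>i. \<kappa> i > 0"
  shows "\<kappa> i \<le> max_asymmetry \<kappa>" "1 / \<kappa> i \<le> max_asymmetry \<kappa>" "1 \<le> max_asymmetry \<kappa>"
proof -
  have "max (\<kappa> i) (1 / \<kappa> i) \<le> max_asymmetry \<kappa>"
    unfolding max_asymmetry_def by (rule Max_ge) auto
  then show *: "\<kappa> i \<le> max_asymmetry \<kappa>" "1 / \<kappa> i \<le> max_asymmetry \<kappa>" by simp_all
  show "1 \<le> max_asymmetry \<kappa>"
  proof (cases "\<kappa> i \<ge> 1")
    case False
    then have "1 \<le> 1 / \<kappa> i" using assms[of i] by simp
    with *(2) show ?thesis by linarith
  qed (use *(1) in linarith)
qed

text \<open>The weight \<open>k\<close> moves from one factor to the other at the price of
  \<open>K\<close>. For \<open>k \<ge> 1\<close> the first factor absorbs \<open>K\<close>, for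
  \<open>k < 1\<close> the second one does.\<close>

lemma block_product_le:
  fixes k K x y u v :: real
  assumes "k > 0" "k \<le> K" "1 / k \<le> K" "x \<ge> 0" "y \<ge> 0" "u \<ge> 0" "v \<ge> 0"
  shows "(k * x + y) * (u + v) \<le> K * ((x + y) * (k * u + v))"
proof (cases "k \<ge> 1")
  case True
  have "k * x + y \<le> K * (x + y)"
    using assms True mult_right_mono[of k K x] mult_right_mono[of 1 K y] by (simp add: algebra_simps)
  moreover have "u + v \<le> k * u + v"
    using True assms(6) mult_right_mono[of 1 k u] by simp
  ultimately have "(k * x + y) * (u + v) \<le> (K * (x + y)) * (k * u + v)"
    using assms by (intro mult_mono) auto
  then show ?thesis by (simp add: mult_ac)
next
  case False
  have K: "K \<ge> 0" "1 \<le> K * k"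
    using assms(1-3) by (simp_all add: field_simps)
  have "k * x + y \<le> x + y"
    using False assms(4) mult_right_mono[of k 1 x] by simp
  moreover have "u + v \<le> K * (k * u + v)"
  proof -
    have "1 \<le> K" using False assms(2) K(2) assms(1) mult_left_le[of k K] by linarith
    then show ?thesis using mult_right_mono[OF K(2) assms(6)] mult_right_mono[of 1 K v] assms(7)
      by (simp add: algebra_simps)
  qed
  ultimately have "(k * x + y) * (u + v) \<le> (x + y) * (K * (k * u + v))"
    using assms K by (intro mult_mono) auto
  then show ?thesis by (simp add: mult_ac)
qed

text \<open>
  Applied with \<open>s = k x + y\<close>, \<open>t = x + y\<close>, \<open>S = k u + v\<close>, \<open>T = u + v\<close>, where \<open>s\<close> and \<open>S\<close> are
  divided by \<open>k\<close> in case \<open>k < 1\<close>. The claim is \<open>(s - S) (t - T) + K/4 s t \<ge> 0\<close>.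
\<close>

lemma cross_product_le:
  fixes s t S T K :: real
  assumes st: "t \<le> s" "s \<le> K * t" and ST: "T \<le> S" "S \<le> K * T" and K: "K \<ge> 1" and "t \<ge> 0"
  shows "s * T + S * t \<le> (1 + K / 4) * (s * t) + S * T"
proof -
  have amgm: "4 * (p * q) \<le> (p + q)\<^sup>2" for p q :: real
    using zero_le_power2[of "p - q"] by (simp add: power2_eq_square algebra_simps)
  have s0: "s \<ge> 0" using st assms(6) by linarith
  have st0: "0 \<le> s * t" using s0 assms(6) by simp
  have "0 \<le> (s - S) * (t - T) + K / 4 * (s * t)"
  proof -
    \<comment> \<open>Only differences of opposite sign need the term with
      \<open>K / 4\<close>.\<close>
    consider "0 \<le> (s - S) * (t - T)" | "S \<ge> s" "t \<ge> T" | "S \<le> s" "t \<le> T"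
      by (cases "S \<ge> s"; cases "t \<ge> T") (auto simp: mult_nonpos_nonpos)
    then show ?thesis
    proof cases
      case 1
      then show ?thesis using st0 K by simp
    next
      case 2
      \<comment> \<open>Weighting \<open>t - T\<close> by \<open>K\<close> lets
        \<open>S \<le> K * T\<close> eliminate \<open>S\<close> and \<open>T\<close> from the
        sum.\<close>
      have "4 * ((S - s) * (K * (t - T))) \<le> (S - s + K * (t - T))\<^sup>2" by (rule amgm)
      also have "\<dots> \<le> (K * t - s)\<^sup>2"
      proof (rule power_mono)
        show "S - s + K * (t - T) \<le> K * t - s" using ST by (simp add: algebra_simps)
        show "0 \<le> S - s + K * (t - T)" using 2 K by simp
      qed
      also have "\<dots> \<le> (K * s) * (K * t)"
        unfolding power2_eq_square
      proof (rule mult_mono)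
        have "K * t \<le> K * s" using st(1) K by (intro mult_left_mono) auto
        then show "K * t - s \<le> K * s" using s0 by linarith
      qed (use st s0 K in auto)
      finally have "K * (4 * ((S - s) * (t - T))) \<le> K * (K * (s * t))" by (simp add: mult_ac)
      then have "4 * ((S - s) * (t - T)) \<le> K * (s * t)" using K by simp
      then show ?thesis by (simp add: algebra_simps)
    next
      case 3
      \<comment> \<open>Here \<open>T \<le> S\<close> eliminates \<open>S\<close> and
        \<open>T\<close>, so no weight is required.\<close>
      have "4 * ((s - S) * (T - t)) \<le> (s - S + (T - t))\<^sup>2" by (rule amgm)
      also have "\<dots> \<le> (s - t)\<^sup>2"
        using 3 ST by (intro power_mono) auto
      also have "\<dots> \<le> s * (K * t)"
        unfolding power2_eq_square using st s0 assms(6) by (intro mult_mono) auto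
      finally show ?thesis by (simp add: algebra_simps)
    qed
  qed
  then show ?thesis by (simp add: algebra_simps)
qed

text \<open>Every term contains exactly one of the factors \<open>k * x + y\<close> and
  \<open>k * u + v\<close>. Hence both may be divided by \<open>k\<close>, which for
  \<open>k < 1\<close> restores the hypotheses of \<open>cross_product_le\<close>.\<close>

lemma block_cross_product_le:
  fixes k K x y u v :: real
  assumes "k > 0" "k \<le> K" "1 / k \<le> K" "x \<ge> 0" "y \<ge> 0" "u \<ge> 0" "v \<ge> 0"
  shows "(k * x + y) * (u + v) + (k * u + v) * (x + y)
    \<le> (1 + K / 4) * ((k * x + y) * (x + y)) + (k * u + v) * (u + v)"
proof (cases "k \<ge> 1")
  case True
  have K: "K \<ge> 1" using True assms(2) by linarith
  have *: "p + q \<le> k * p + q" "k * p + q \<le> K * (p + q)" if "p \<ge> 0" "q \<ge> 0" for p q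
    using that True K mult_right_mono[of 1 k p] mult_right_mono[OF assms(2), of p]
      mult_right_mono[of 1 K q] by (simp_all add: algebra_simps)
  show ?thesis
    using assms by (intro cross_product_le * K) auto
next
  case False
  have K: "K \<ge> 1" using False assms(1,3) by (smt (verit) le_divide_eq_1_pos)
  have *: "p + q \<le> (k * p + q) / k" "(k * p + q) / k \<le> K * (p + q)" if "p \<ge> 0" "q \<ge> 0" for p q
  proof -
    have e: "(k * p + q) / k = p + (1 / k) * q" using assms(1) by (simp add: field_simps)
    have "1 \<le> 1 / k" using False assms(1) by simp
    then show "p + q \<le> (k * p + q) / k"
      unfolding e using mult_right_mono[of 1 "1 / k" q] that by simp
    show "(k * p + q) / k \<le> K * (p + q)"
      unfolding e using mult_right_mono[OF assms(3), of q] mult_right_mono[OF K, of p] that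
      by (simp add: algebra_simps)
  qed
  have "(k * x + y) / k * (u + v) + (k * u + v) / k * (x + y)
    \<le> (1 + K / 4) * ((k * x + y) / k * (x + y)) + (k * u + v) / k * (u + v)"
    using assms by (intro cross_product_le * K) auto
  from mult_left_mono[OF this, of k] assms(1) show ?thesis by (simp add: distrib_left)
qed

text \<open>On each road the square of \<open>s T\<close> is at most \<open>K (s t) (S T)\<close>;
  the arithmetic-geometric mean inequality with weight \<open>l\<close> then gives the
  summand.\<close>

lemma block_matrix_smoothness:
  assumes pos: "\<And>i. \<kappa> i > 0" "\<And>i. a i > 0" and K: "K = max_asymmetry \<kappa>" and l: "l > 0"
    and z: "\<And>r. z $ r \<ge> 0" and w: "\<And>r. w $ r \<ge> 0"
  shows "w \<bullet> (block_matrix \<kappa> a *v z)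
    \<le> l * (z \<bullet> (block_matrix \<kappa> a *v z)) + K / (4 * l) * (w \<bullet> (block_matrix \<kappa> a *v w))"
proof -
  note bounds = max_asymmetry_bounds[of \<kappa>, OF pos(1), folded K]
  define s t S T where "s i = \<kappa> i * z $ (i, Regular) + z $ (i, Smart)"
    and "t i = z $ (i, Regular) + z $ (i, Smart)"
    and "S i = \<kappa> i * w $ (i, Regular) + w $ (i, Smart)"
    and "T i = w $ (i, Regular) + w $ (i, Smart)" for i
  have nonneg: "s i \<ge> 0" "t i \<ge> 0" "S i \<ge> 0" "T i \<ge> 0" for i
    using z w pos(1)[of i] by (simp_all add: s_def t_def S_def T_def)
  have "a i * (s i * T i) \<le> l * (a i * (s i * t i)) + K / (4 * l) * (a i * (S i * T i))" for i
  proof -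
    have "s i * T i \<le> l * (s i * t i) + K / (4 * l) * (S i * T i)"
    proof (rule le_add_of_square_le)
      have "s i * T i \<le> K * (t i * S i)"
        unfolding s_def T_def t_def S_def
        by (intro block_product_le pos(1) bounds(1,2) z w)
      \<comment> \<open>Only one of the two copies of \<open>s i * T i\<close> is replaced by its
        bound.\<close>
      then have "(s i * T i) * (s i * T i) \<le> (s i * T i) * (K * (t i * S i))"
        using nonneg by (intro mult_left_mono) auto
      also have "\<dots> = 4 * (l * (s i * t i)) * (K / (4 * l) * (S i * T i))"
        using l by simp
      finally show "(s i * T i)\<^sup>2 \<le> 4 * (l * (s i * t i)) * (K / (4 * l) * (S i * T i))"
        by (simp add: power2_eq_square)
    qed (use nonneg l bounds(3) in auto)
    from mult_left_mono[OF this, of "a i"] pos(2)[of i] show ?thesis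
      by (simp add: algebra_simps)
  qed
  then have "(\<Sum>i\<in>UNIV. a i * (s i * T i))
      \<le> (\<Sum>i\<in>UNIV. l * (a i * (s i * t i)) + K / (4 * l) * (a i * (S i * T i)))"
    by (rule sum_mono)
  then show ?thesis
    unfolding inner_block_matrix s_def t_def S_def T_def
    by (simp add: sum.distrib sum_distrib_left)
qed

lemma block_matrix_cross_le:
  assumes pos: "\<And>i. \<kappa> i > 0" "\<And>i. a i > 0" and K: "K = max_asymmetry \<kappa>"
    and z: "\<And>r. z $ r \<ge> 0" and w: "\<And>r. w $ r \<ge> 0"
  shows "w \<bullet> (block_matrix \<kappa> a *v z) + z \<bullet> (block_matrix \<kappa> a *v w)
    \<le> (1 + K / 4) * (z \<bullet> (block_matrix \<kappa> a *v z)) + w \<bullet> (block_matrix \<kappa> a *v w)"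
proof -
  note bounds = max_asymmetry_bounds[of \<kappa>, OF pos(1), folded K]
  show ?thesis
    unfolding inner_block_matrix sum_distrib_left sum.distrib[symmetric]
  proof (rule sum_mono)
    fix i
    have "(\<kappa> i * z $ (i, Regular) + z $ (i, Smart)) * (w $ (i, Regular) + w $ (i, Smart)) +
        (\<kappa> i * w $ (i, Regular) + w $ (i, Smart)) * (z $ (i, Regular) + z $ (i, Smart))
      \<le> (1 + K / 4) *
          ((\<kappa> i * z $ (i, Regular) + z $ (i, Smart)) * (z $ (i, Regular) + z $ (i, Smart))) +
        (\<kappa> i * w $ (i, Regular) + w $ (i, Smart)) * (w $ (i, Regular) + w $ (i, Smart))"
      by (intro block_cross_product_le pos(1) bounds(1,2) z w)
    from mult_left_mono[OF this, of "a i"] pos(2)[of i] show "a i * ((\<kappa> i * z $ (i, Regular) + z $ (i, Smart)) * (w $ (i, Regular) + w $ (i, Smart))) +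
        a i * ((\<kappa> i * w $ (i, Regular) + w $ (i, Smart)) * (z $ (i, Regular) + z $ (i, Smart)))
      \<le> (1 + K / 4) *
          (a i * ((\<kappa> i * z $ (i, Regular) + z $ (i, Smart)) * (z $ (i, Regular) + z $ (i, Smart)))) +
        a i * ((\<kappa> i * w $ (i, Regular) + w $ (i, Smart)) * (w $ (i, Regular) + w $ (i, Smart)))"
      by (simp add: distrib_left mult.left_commute[of "a i" "1 + K / 4"])
  qed
qed

lemma block_matrix_nonneg:
  assumes "\<And>i. \<kappa> i > 0" "\<And>i. a i > 0" "\<And>r. z $ r \<ge> 0" "\<And>r. w $ r \<ge> 0"
  shows "w \<bullet> (block_matrix \<kappa> a *v z) \<ge> 0"
  unfolding inner_block_matrix using assms by (intro sum_nonneg) (simp add: less_imp_le)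

section \<open>Inequalities for the positive definite part\<close>

lemma positive_definite_nonneg: "positive_definite P \<Longrightarrow> x \<bullet> (P *v x) \<ge> 0"
  by (cases "x = 0") (auto simp: positive_definite_def less_imp_le)

text \<open>Read off from \<open>eta_squared_bound\<close> with both arguments equal to one nonzero
  vector.\<close>

lemma eta_squared_nonneg:
  assumes "positive_definite P"
  shows "eta_squared P \<ge> 0"
proof -
  define x :: "real ^ 'a" where "x = 1"
  have "x \<bullet> (P *v x) > 0" using assms by (simp add: positive_definite_def x_def)
  moreover have "0 \<le> eta_squared P * (x \<bullet> (P *v x)) * (x \<bullet> (P *v x))"
    using eta_squared_bound[OF assms, of x x] by (rule order_trans[OF zero_le_power2])
  ultimately show ?thesis by (simp add: zero_le_mult_iff)
qed

lemma positive_definite_smoothness: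
  assumes P: "positive_definite P" and l: "l > 0"
  shows "w \<bullet> (P *v z) \<le> l * (z \<bullet> (P *v z)) + eta_squared P / (4 * l) * (w \<bullet> (P *v w))"
proof (rule le_add_of_square_le)
  show "(w \<bullet> (P *v z))\<^sup>2 \<le> 4 * (l * (z \<bullet> (P *v z))) * (eta_squared P / (4 * l) * (w \<bullet> (P *v w)))"
    using eta_squared_bound[OF P, of w z] l by (simp add: mult_ac)
qed (use l positive_definite_nonneg[OF P] eta_squared_nonneg[OF P] in auto)

lemma positive_definite_cross_le:
  assumes P: "positive_definite P"
  shows "w \<bullet> (P *v z) + z \<bullet> (P *v w) \<le> z \<bullet> (P *v z) + w \<bullet> (P *v w)"
  using positive_definite_nonneg[OF P, of "z - w"]
  by (simp add: matrix_vector_mult_diff_distrib inner_diff_left inner_diff_right)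

section \<open>The two bounds on the equilibrium cost\<close>

theorem theorem3:
  fixes \<Gamma> :: "('v, 'e::finite) routing_game"
    and Q P :: "'e matrix"
    and \<kappa> a :: "'e \<Rightarrow> real"
    and k :: real
    and z_EQ :: "'e flow"
  assumes "mixed_autonomy_game \<Gamma>"
    and "wardrop_equilibrium \<Gamma> z_EQ"
    and "cost_matrix \<Gamma> = Q + P"
    and "\<And>i. \<kappa> i > 0" and "\<And>i. a i > 0"
    and "Q = block_matrix \<kappa> a"
    and "positive_definite P"
    and "k = max_asymmetry \<kappa>"
  shows "(\<forall>z_OPT. social_optimum \<Gamma> z_OPT \<and> k < 4 \<longrightarrow>
            social_cost \<Gamma> z_EQ \<le> (4 / (4 - k) + eta_squared P) * social_cost \<Gamma> z_OPT) \<and>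
         (\<forall>w_OPT. social_optimum (scale_players (2 + k / 4) \<Gamma>) w_OPT \<longrightarrow>
            social_cost \<Gamma> z_EQ \<le> social_cost \<Gamma> w_OPT)"
proof -
  note game = assms(1) and A = assms(3) and pos = assms(4,5) and Q = assms(6)
    and P = assms(7) and k = assms(8)
  define \<beta> :: "'e flow" where "\<beta> = (\<chi> r. free_flow_delay \<Gamma> (fst r))"
  define H where "H = eta_squared P"
  define q p where "q z w = w \<bullet> (Q *v z)" and "p z w = w \<bullet> (P *v z)" for z w
  have cost: "cost \<Gamma> z \<bullet> w = q z w + p z w + \<beta> \<bullet> w" for z w
    by (simp add: cost_def A \<beta>_def[symmetric] q_def p_def matrix_vector_mult_add_rdistrib
        inner_add_left inner_commute[of w])
  have C: "social_cost \<Gamma> z = q z z + p z z + \<beta> \<bullet> z" for z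
    by (simp add: social_cost_def cost)
  have k1: "k \<ge> 1" using max_asymmetry_bounds(3)[of \<kappa>, OF pos(1)] k by simp
  have H0: "H \<ge> 0" using eta_squared_nonneg[OF P] by (simp add: H_def)
  have z: "z_EQ $ r \<ge> 0" for r
    using assms(2) feasible_routing_nonneg
    unfolding wardrop_equilibrium_def feasible_routings_def by blast
  have q0: "q u w \<ge> 0" if "\<And>r. u $ r \<ge> 0" "\<And>r. w $ r \<ge> 0" for u w
    using block_matrix_nonneg[of \<kappa> a, OF pos that] by (simp add: q_def Q)
  have p0: "p w w \<ge> 0" for w using positive_definite_nonneg[OF P] by (simp add: p_def)
  have \<beta>0: "\<beta> \<bullet> w \<ge> 0" if "\<And>r. w $ r \<ge> 0" for w
    using game that
    by (auto simp: mixed_autonomy_game_def \<beta>_def inner_vec_def intro!: sum_nonneg)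
  have C0: "social_cost \<Gamma> w \<ge> 0" if "\<And>r. w $ r \<ge> 0" for w
    using q0[OF that that] p0[of w] \<beta>0[OF that] by (simp add: C)
  \<comment> \<open>The estimate behind every case of (a). \<open>M\<close> dominates the
    coefficients of \<open>q w w\<close>, \<open>p w w\<close> and
    \<open>\<beta> \<bullet> w\<close>; adding \<open>l * (\<beta> \<bullet> z_EQ)\<close> completes
    the remaining terms to \<open>l * social_cost \<Gamma> z_EQ\<close>.\<close>
  have smooth: "(1 - l) * social_cost \<Gamma> z_EQ \<le> M * social_cost \<Gamma> w"
    if w: "w \<in> feasible_routings \<Gamma>" and l: "0 < l" and M: "k / (4 * l) \<le> M" "H / (4 * l) \<le> M" "1 \<le> M"
    for w l M
  proof -
    have w0: "w $ r \<ge> 0" for r using feasible_routing_nonneg[OF w] .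
    have "social_cost \<Gamma> z_EQ \<le> q z_EQ w + p z_EQ w + \<beta> \<bullet> w"
      using wardrop_equilibrium_inner_le[OF game assms(2) w] by (simp add: social_cost_def cost)
    moreover have "q z_EQ w \<le> l * q z_EQ z_EQ + k / (4 * l) * q w w"
      unfolding q_def Q by (rule block_matrix_smoothness[of \<kappa> a, OF pos k l z w0])
    moreover have "p z_EQ w \<le> l * p z_EQ z_EQ + H / (4 * l) * p w w"
      unfolding p_def H_def by (rule positive_definite_smoothness[OF P l])
    moreover have "k / (4 * l) * q w w \<le> M * q w w"
      using M(1) q0[OF w0 w0] by (rule mult_right_mono)
    moreover have "H / (4 * l) * p w w \<le> M * p w w"
      using M(2) p0 by (rule mult_right_mono)
    moreover have "\<beta> \<bullet> w \<le> M * (\<beta> \<bullet> w)"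
      using mult_right_mono[OF M(3) \<beta>0[OF w0]] by simp
    moreover have "0 \<le> l * (\<beta> \<bullet> z_EQ)" using l \<beta>0[OF z] by simp
    ultimately show ?thesis by (simp add: C algebra_simps)
  qed
  have "social_cost \<Gamma> z_EQ \<le> (4 / (4 - k) + H) * social_cost \<Gamma> w"
    if w: "w \<in> feasible_routings \<Gamma>" and k4: "k < 4" for w
  proof -
    have w0: "social_cost \<Gamma> w \<ge> 0" using feasible_routing_nonneg[OF w] by (rule C0)
    consider "H \<le> k" | "k < H" "H < 2" | "k < H" "2 \<le> H" by linarith
    then obtain c where c: "social_cost \<Gamma> z_EQ \<le> c * social_cost \<Gamma> w" "c \<le> 4 / (4 - k) + H"
    proof cases
      case 1
      \<comment> \<open>\<lambda> = k/4 makes k/(4\<lambda>) = 1, and H/(4\<lambda>) = H/k is at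
        most 1.\<close>
      have "(1 - k / 4) * social_cost \<Gamma> z_EQ \<le> 1 * social_cost \<Gamma> w"
        using k1 1 by (intro smooth[OF w]) auto
      then have "social_cost \<Gamma> z_EQ \<le> 4 / (4 - k) * social_cost \<Gamma> w"
        using k4 by (simp add: field_simps)
      then show ?thesis by (rule that) (use H0 in simp)
    next
      case 2
      \<comment> \<open>\<lambda> = H/4 makes H/(4\<lambda>) = 1 and k/(4\<lambda>) = k/H <
        1.\<close>
      have "(1 - H / 4) * social_cost \<Gamma> z_EQ \<le> 1 * social_cost \<Gamma> w"
        using k1 2 by (intro smooth[OF w]) auto
      then have *: "social_cost \<Gamma> z_EQ \<le> 4 / (4 - H) * social_cost \<Gamma> w"
        using 2 by (simp add: field_simps)
      \<comment> \<open>The target is at least 2 as well, because 4/(4 - k) >= 1 and H > k >=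
        1.\<close>
      have "4 / (4 - H) \<le> 2" using 2 by (simp add: field_simps)
      moreover have "1 \<le> 4 / (4 - k)" using k1 k4 by (simp add: field_simps)
      ultimately show ?thesis by (intro that[OF *]) (use k1 2 in linarith)
    next
      case 3
      \<comment> \<open>\<lambda> = 1/2 with M = H/2, which is at least 1 since H >= 2 and at least
        k/2 since H > k.\<close>
      have "(1 - 1 / 2) * social_cost \<Gamma> z_EQ \<le> (H / 2) * social_cost \<Gamma> w"
        using 3 by (intro smooth[OF w]) auto
      then have "social_cost \<Gamma> z_EQ \<le> H * social_cost \<Gamma> w" by simp
      then show ?thesis by (rule that) (use k4 in simp)
    qed
    then show ?thesis using mult_right_mono[OF c(2) w0] by linarith
  qed
  moreover have "social_cost \<Gamma> z_EQ \<le> social_cost \<Gamma> w"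
    if w: "w \<in> feasible_routings (scale_players (2 + k / 4) \<Gamma>)" for w
  proof -
    let ?p = "2 + k / 4"
    have w0: "w $ r \<ge> 0" for r using feasible_routing_nonneg[OF w] .
    have "social_cost \<Gamma> z_EQ \<le> cost \<Gamma> z_EQ \<bullet> ((1 / ?p) *\<^sub>R w)"
      unfolding social_cost_def
      using k1 by (intro wardrop_equilibrium_inner_le[OF game assms(2)]
          feasible_routing_scale_players[OF w]) simp
    also have "\<dots> = (q z_EQ w + p z_EQ w + \<beta> \<bullet> w) / ?p"
      by (simp add: cost[symmetric])
    finally have "?p * social_cost \<Gamma> z_EQ \<le> q z_EQ w + p z_EQ w + \<beta> \<bullet> w"
      using k1 by (simp add: pos_le_divide_eq mult.commute)
    \<comment> \<open>Nonnegativity of the entries is available only for the sum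
      \<open>Q + P\<close>, as \<open>P\<close> may have negative entries, so \<open>q\<close> and
      \<open>p\<close> are symmetrised together.\<close>
    moreover have "0 \<le> q w z_EQ + p w z_EQ"
    proof -
      have "0 \<le> z_EQ \<bullet> (cost_matrix \<Gamma> *v w)"
        using game z w0 by (auto simp: mixed_autonomy_game_def inner_vec_def
            matrix_vector_mult_def intro!: sum_nonneg mult_nonneg_nonneg)
      then show ?thesis
        by (simp add: A q_def p_def matrix_vector_mult_add_rdistrib inner_add_right)
    qed
    moreover have "q z_EQ w + q w z_EQ \<le> (1 + k / 4) * q z_EQ z_EQ + q w w"
      unfolding q_def Q by (rule block_matrix_cross_le[of \<kappa> a, OF pos k z w0])
    moreover have "p z_EQ w + p w z_EQ \<le> p z_EQ z_EQ + p w w"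
      unfolding p_def by (rule positive_definite_cross_le[OF P])
    \<comment> \<open>After subtracting the cross bounds from
      \<open>(2 + k / 4) * social_cost \<Gamma> z_EQ\<close>, what exceeds
      \<open>social_cost \<Gamma> z_EQ\<close> is exactly these two terms.\<close>
    moreover have "0 \<le> k / 4 * p z_EQ z_EQ" "0 \<le> (1 + k / 4) * (\<beta> \<bullet> z_EQ)"
      using k1 p0 \<beta>0[OF z] by auto
    ultimately show ?thesis by (simp add: C algebra_simps)
  qed
  ultimately show ?thesis unfolding social_optimum_def H_def by blast
qed

end
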